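(* Let $\|\cdot\|_D$ be an arbitrary $D$-norm on $\mathbb{R}^d$, and set $\|\cdot\|_{D^{(i)}}:=\|\cdot\|_D$ for every $i\in\mathbb{N}$. Then the limit $$\lim_{n\to\infty}\|\bm{x}\|_{\prod_{i=1}^n D^{(i)}}=:\|\bm{x}\|_{D^*},\qquad \bm{x}\in\mathbb{R}^d,$$ is an idempotent $D$-norm on $\mathbb{R}^d$.
   Context: A generator is a random vector $\bm{Z}=(Z_1,\dots,Z_d)$ with $Z_i\ge 0$ almost surely and $E(Z_i)=1$ for $1\le i\le d$. The $D$-norm on $\mathbb{R}^d$ generated by $\bm{Z}$ is $\|\bm{x}\|_D:=E\left(\max_{1\le i\le d}(|x_i|Z_i)\right)$, $\bm{x}\in\mathbb{R}^d$. A $D$-norm is a norm on $\mathbb{R}^d$ that arises in this way from some generator; the generator of a $D$-norm is not unique. For two $D$-norms $\|\cdot\|_{D^{(1)}}$, $\|\cdot\|_{D^{(2)}}$ on $\mathbb{R}^d$, their product $\|\cdot\|_{D^{(1)}D^{(2)}}$ is the $D$-norm generated by the componentwise product $\bm{Z}^{(1)}\bm{Z}^{(2)}$, where $\bm{Z}^{(1)}$, $\bm{Z}^{(2)}$ are independent generators of $\|\cdot\|_{D^{(1)}}$, $\|\cdot\|_{D^{(2)}}$; it does not depend on the choice of these independent generators. Iterated products are defined by $\|\cdot\|_{\prod_{i=1}^{1}D^{(i)}}:=\|\cdot\|_{D^{(1)}}$ and $\|\cdot\|_{\prod_{i=1}^{n+1}D^{(i)}}:=\|\cdot\|_{D^{(n+1)}\prod_{i=1}^n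 D^{(i)}}$, $n\in\mathbb{N}$. A $D$-norm is called idempotent if $\|\cdot\|_{D^2}:=\|\cdot\|_{DD}=\|\cdot\|_D$. *)

theory Defs
  imports "HOL-Probability.Probability"
begin

(* Integrability of the components need not be demanded separately: the Bochner
   integral of a non-integrable function is 0, so expectation 1 implies it. *)
definition generator :: "'a measure \<Rightarrow> ('a \<Rightarrow> real ^ 'd) \<Rightarrow> bool" where
  "generator M Z \<longleftrightarrow>
     prob_space M \<and> Z \<in> borel_measurable M \<and>
     (\<forall>i. AE \<omega> in M. 0 \<le> Z \<omega> $ i) \<and>
     (\<forall>i. (\<integral>\<omega>. Z \<omega> $ i \<partial>M) = 1)"

definition generated_norm :: "'a measure \<Rightarrow> ('a \<Rightarrow> real ^ 'd) \<Rightarrow> real ^ 'd \<Rightarrow> real" where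
  "generated_norm M Z x = (\<integral>\<omega>. (MAX i. \<bar>x $ i\<bar> * Z \<omega> $ i) \<partial>M)"

(* HOL cannot quantify over the type of the sample space inside a definition. Taking it to be
   R^d loses no generality (see D_norm_generated_norm): a generator can be
   replaced by the identity on R^d equipped with the law of the generator. That such an N is
   a norm is a consequence (see D_norm_imp_norm). *)
definition D_norm :: "(real ^ 'd \<Rightarrow> real) \<Rightarrow> bool" where
  "D_norm N \<longleftrightarrow>
     (\<exists>(M :: (real ^ 'd) measure) Z. generator M Z \<and> N = generated_norm M Z)"

(* D_prod N1 N2 is meaningful for D-norms N1, N2 only. The defining description is then
   satisfied by exactly one N (see D_prod_well_defined), and independent
   generators on any other probability space give the same N (see D_prod_generated_norm). *)
definition D_prod :: "(real ^ 'd \<Rightarrow> real) \<Rightarrow> (real ^ 'd \<Rightarrow> real) \<Rightarrow> real ^ 'd \<Rightarrow> real" where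
  "D_prod N1 N2 =
     (THE N. \<exists>(M :: ((real ^ 'd) \<times> (real ^ 'd)) measure) Z1 Z2.
        generator M Z1 \<and> N1 = generated_norm M Z1 \<and>
        generator M Z2 \<and> N2 = generated_norm M Z2 \<and>
        prob_space.indep_var M borel Z1 borel Z2 \<and>
        N = generated_norm M (\<lambda>\<omega>. \<chi> i. Z1 \<omega> $ i * Z2 \<omega> $ i))"

(* Factors are numbered from 1; the value at n = 0 is a mere convention (the sup-norm,
   generated by the constant vector (1,...,1)) that no other equation refers to. *)
fun D_iprod :: "(nat \<Rightarrow> real ^ 'd \<Rightarrow> real) \<Rightarrow> nat \<Rightarrow> real ^ 'd \<Rightarrow> real" where
  "D_iprod N 0 = infnorm"
| "D_iprod N (Suc 0) = N 1"
| "D_iprod N (Suc (Suc n)) = D_prod (N (Suc (Suc n))) (D_iprod N (Suc n))"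

definition idempotent_D_norm :: "(real ^ 'd \<Rightarrow> real) \<Rightarrow> bool" where
  "idempotent_D_norm N \<longleftrightarrow> D_norm N \<and> D_prod N N = N"


lemma generatorD:
  assumes "generator M Z"
  shows "prob_space M" "Z \<in> borel_measurable M" "AE \<omega> in M. \<forall>i. 0 \<le> Z \<omega> $ i"
    "integrable M (\<lambda>\<omega>. Z \<omega> $ i)" "(\<integral>\<omega>. Z \<omega> $ i \<partial>M) = 1"
proof -
  have *: "\<And>i. (\<integral>\<omega>. Z \<omega> $ i \<partial>M) = 1" using assms unfolding generator_def by auto
  then show "(\<integral>\<omega>. Z \<omega> $ i \<partial>M) = 1" .
  show "integrable M (\<lambda>\<omega>. Z \<omega> $ i)"
    using *[of i] not_integrable_integral_eq[of M "\<lambda>\<omega>. Z \<omega> $ i"] by force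
  have "AE \<omega> in M. \<forall>i\<in>UNIV. 0 \<le> Z \<omega> $ i"
    using assms unfolding generator_def by (intro AE_finite_allI) auto
  then show "AE \<omega> in M. \<forall>i. 0 \<le> Z \<omega> $ i" by simp
qed (use assms in \<open>auto simp: generator_def\<close>)

lemma measurable_vec_nth [measurable]: "(\<lambda>z :: real ^ 'd. z $ i) \<in> borel_measurable borel"
  by (intro borel_measurable_continuous_onI continuous_intros)

lemma measurable_vec_nth' [measurable (raw)]:
  fixes Z :: "'a \<Rightarrow> real ^ 'd"
  shows "Z \<in> borel_measurable M \<Longrightarrow> (\<lambda>\<omega>. Z \<omega> $ i) \<in> borel_measurable M"
  using measurable_compose[OF _ measurable_vec_nth] .

lemma measurable_vec_lambda [measurable (raw)]:
  fixes f :: "'a \<Rightarrow> 'd :: finite \<Rightarrow> real"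
  assumes "\<And>i. (\<lambda>\<omega>. f \<omega> i) \<in> borel_measurable M"
  shows "(\<lambda>\<omega>. \<chi> i. f \<omega> i) \<in> borel_measurable M"
  by (rule borel_measurable_euclidean_space[THEN iffD2])
     (use assms in \<open>auto simp: Basis_vec_def inner_axis\<close>)

lemma measurable_MAX [measurable (raw)]:
  fixes f :: "'a \<Rightarrow> 'd :: finite \<Rightarrow> real"
  assumes "\<And>i. (\<lambda>\<omega>. f \<omega> i) \<in> borel_measurable M"
  shows "(\<lambda>\<omega>. MAX i. f \<omega> i) \<in> borel_measurable M"
  using borel_measurable_Max[of UNIV "\<lambda>i \<omega>. f \<omega> i" M] assms by simp

lemma abs_MAX_le_sum:
  fixes f :: "'d :: finite \<Rightarrow> real"
  shows "\<bar>MAX i. f i\<bar> \<le> (\<Sum>i\<in>UNIV. \<bar>f i\<bar>)"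
proof -
  have "Max (range f) \<in> range f" by (intro Max_in) auto
  then obtain i where "Max (range f) = f i" by (rule rangeE)
  then show ?thesis by (metis UNIV_I finite member_le_sum abs_ge_zero)
qed

lemma integrable_MAX:
  fixes f :: "'a \<Rightarrow> 'd :: finite \<Rightarrow> real"
  assumes "\<And>i. integrable M (\<lambda>\<omega>. f \<omega> i)"
  shows "integrable M (\<lambda>\<omega>. MAX i. f \<omega> i)"
proof (rule Bochner_Integration.integrable_bound[where f = "\<lambda>\<omega>. \<Sum>i\<in>UNIV. \<bar>f \<omega> i\<bar>"])
  show "integrable M (\<lambda>\<omega>. \<Sum>i\<in>UNIV. \<bar>f \<omega> i\<bar>)" using assms by auto
  show "(\<lambda>\<omega>. MAX i. f \<omega> i) \<in> borel_measurable M"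
    using assms by (intro measurable_MAX) auto
  show "AE \<omega> in M. norm (MAX i. f \<omega> i) \<le> norm (\<Sum>i\<in>UNIV. \<bar>f \<omega> i\<bar>)"
    using abs_MAX_le_sum[of "f _"] by (auto intro!: AE_I2 simp: sum_nonneg)
qed

lemma D_norm_imp_norm:
  fixes N :: "real ^ 'd \<Rightarrow> real"
  assumes "D_norm N"
  shows "0 \<le> N x" and "N x = 0 \<longleftrightarrow> x = 0" and "N (c *\<^sub>R x) = \<bar>c\<bar> * N x" and "N (x + y) \<le> N x + N y"
proof -
  obtain M :: "(real ^ 'd) measure" and Z where gen: "generator M Z" and N: "N = generated_norm M Z"
    using assms unfolding D_norm_def by blast
  note Z = generatorD[OF gen]
  let ?f = "\<lambda>x \<omega>. MAX i. \<bar>x $ i\<bar> * Z \<omega> $ i"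
  have int: "integrable M (?f x)" for x :: "real ^ 'd"
    by (intro integrable_MAX integrable_mult_right Z)
  have ge: "\<bar>x $ i\<bar> \<le> N x" for x i
  proof -
    have "(\<integral>\<omega>. \<bar>x $ i\<bar> * Z \<omega> $ i \<partial>M) \<le> (\<integral>\<omega>. ?f x \<omega> \<partial>M)"
      by (intro integral_mono int integrable_mult_right Z Max_ge) auto
    then show ?thesis using Z(5)[of i] by (simp add: N generated_norm_def)
  qed
  show "0 \<le> N x" using ge[of x undefined] by linarith
  have "N 0 = 0" by (simp add: N generated_norm_def)
  then show "N x = 0 \<longleftrightarrow> x = 0" using ge[of x] by (metis abs_le_zero_iff vec_eq_iff zero_index)
  have "?f (c *\<^sub>R x) \<omega> = \<bar>c\<bar> * ?f x \<omega>" for \<omega>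
  proof -
    have "mono ((*) \<bar>c\<bar>)" by (intro monoI mult_left_mono) auto
    from mono_Max_commute[OF this, of "range (\<lambda>i. \<bar>x $ i\<bar> * Z \<omega> $ i)"]
    show ?thesis by (simp add: image_image abs_mult mult.assoc)
  qed
  then show "N (c *\<^sub>R x) = \<bar>c\<bar> * N x" by (simp add: N generated_norm_def)
  have "(\<integral>\<omega>. ?f (x + y) \<omega> \<partial>M) \<le> (\<integral>\<omega>. ?f x \<omega> + ?f y \<omega> \<partial>M)"
  proof (rule integral_mono_AE)
    show "AE \<omega> in M. ?f (x + y) \<omega> \<le> ?f x \<omega> + ?f y \<omega>"
      using Z(3)
    proof eventually_elim
      case (elim \<omega>)
      have "\<bar>(x + y) $ i\<bar> * Z \<omega> $ i \<le> ?f x \<omega> + ?f y \<omega>" for i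
      proof -
        have "\<bar>(x + y) $ i\<bar> * Z \<omega> $ i \<le> (\<bar>x $ i\<bar> + \<bar>y $ i\<bar>) * Z \<omega> $ i"
          using elim by (intro mult_right_mono) auto
        also have "\<dots> = \<bar>x $ i\<bar> * Z \<omega> $ i + \<bar>y $ i\<bar> * Z \<omega> $ i"
          by (rule distrib_right)
        also have "\<dots> \<le> ?f x \<omega> + ?f y \<omega>" by (intro add_mono Max_ge) auto
        finally show ?thesis .
      qed
      then show ?case by (intro Max.boundedI) auto
    qed
  qed (intro int Bochner_Integration.integrable_add)+
  then show "N (x + y) \<le> N x + N y" using int by (simp add: N generated_norm_def)
qed

lemma generator_distr:
  assumes "generator M Z"
  shows "generator (distr M borel Z) (\<lambda>z. z)"
    and "generated_norm (distr M borel Z) (\<lambda>z. z) = generated_norm M Z"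
proof -
  note Z = generatorD[OF assms]
  note [measurable] = Z(2)
  have "AE \<omega> in M. 0 \<le> Z \<omega> $ i" for i using Z(3) by auto
  then show "generator (distr M borel Z) (\<lambda>z. z)"
    unfolding generator_def using Z(5)
    by (auto simp: AE_distr_iff integral_distr intro: prob_space.prob_space_distr Z)
  show "generated_norm (distr M borel Z) (\<lambda>z. z) = generated_norm M Z"
    unfolding generated_norm_def by (auto simp: integral_distr)
qed

lemma D_norm_generated_norm:
  assumes "generator M Z"
  shows "D_norm (generated_norm M Z)"
  unfolding D_norm_def using generator_distr[OF assms] by metis

lemma generated_norm_pair:
  fixes Z1 :: "'a \<Rightarrow> real ^ 'd" and Z2 :: "'b \<Rightarrow> real ^ 'd"
  assumes "generator M1 Z1" "generator M2 Z2"
  defines "Z \<equiv> \<lambda>\<omega>. \<chi> i. Z1 (fst \<omega>) $ i * Z2 (snd \<omega>) $ i"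
  shows "generator (M1 \<Otimes>\<^sub>M M2) Z"
    and "generated_norm (M1 \<Otimes>\<^sub>M M2) Z x = (\<integral>\<omega>. generated_norm M2 Z2 (\<chi> i. x $ i * Z1 \<omega> $ i) \<partial>M1)"
    and "generated_norm (M1 \<Otimes>\<^sub>M M2) Z x = (\<integral>\<omega>. generated_norm M1 Z1 (\<chi> i. x $ i * Z2 \<omega> $ i) \<partial>M2)"
proof -
  note Z1 = generatorD[OF assms(1)] and Z2 = generatorD[OF assms(2)]
  interpret M1: prob_space M1 by fact
  interpret M2: prob_space M2 by fact
  interpret pair_prob_space M1 M2 ..
  note [measurable] = Z1(2) Z2(2)
  have int: "integrable (M1 \<Otimes>\<^sub>M M2) (\<lambda>(a, b). Z1 a $ i * Z2 b $ i)" for i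
    by (intro Fubini_integrable) (use Z1(4) Z2(4) in \<open>auto simp: abs_mult\<close>)
  have one: "(\<integral>\<omega>. Z \<omega> $ i \<partial>(M1 \<Otimes>\<^sub>M M2)) = 1" for i
    using integral_fst'[OF int[of i]] Z1(5) Z2(5) by (simp add: Z_def split_beta')
  have "AE \<omega> in M1 \<Otimes>\<^sub>M M2. 0 \<le> Z1 (fst \<omega>) $ i \<and> 0 \<le> Z2 (snd \<omega>) $ i" for i
  proof (rule AE_pair_measure)
    show "AE a in M1. AE b in M2. 0 \<le> Z1 (fst (a, b)) $ i \<and> 0 \<le> Z2 (snd (a, b)) $ i"
      using Z1(3)
    proof eventually_elim
      case (elim a)
      show ?case using Z2(3) by eventually_elim (use elim in auto)
    qed
  qed measurable
  note pos = this
  have nn: "AE \<omega> in M1 \<Otimes>\<^sub>M M2. 0 \<le> Z \<omega> $ i" for i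
    using pos[of i] by eventually_elim (simp add: Z_def)
  show "generator (M1 \<Otimes>\<^sub>M M2) Z"
    unfolding generator_def using one nn
    by (auto simp: Z_def intro!: prob_space_axioms)
  let ?f = "\<lambda>a b. MAX i. \<bar>x $ i\<bar> * (Z1 a $ i * Z2 b $ i)"
  have eq: "generated_norm (M1 \<Otimes>\<^sub>M M2) Z x = integral\<^sup>L (M1 \<Otimes>\<^sub>M M2) (case_prod ?f)"
    by (simp add: generated_norm_def Z_def split_beta')
  have intf: "integrable (M1 \<Otimes>\<^sub>M M2) (case_prod ?f)"
    using integrable_MAX[of "M1 \<Otimes>\<^sub>M M2" "\<lambda>\<omega> i. \<bar>x $ i\<bar> * (Z1 (fst \<omega>) $ i * Z2 (snd \<omega>) $ i)"] int
    by (simp add: split_beta')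
  have "(\<integral>a. (\<integral>b. ?f a b \<partial>M2) \<partial>M1)
      = (\<integral>\<omega>. generated_norm M2 Z2 (\<chi> i. x $ i * Z1 \<omega> $ i) \<partial>M1)"
    unfolding generated_norm_def
  proof (rule integral_cong_AE)
    show "AE a in M1. (\<integral>b. ?f a b \<partial>M2)
        = (\<integral>b. (MAX i. \<bar>(\<chi> i. x $ i * Z1 a $ i) $ i\<bar> * Z2 b $ i) \<partial>M2)"
      using Z1(3) by eventually_elim (simp add: abs_mult ac_simps)
  qed measurable
  then show "generated_norm (M1 \<Otimes>\<^sub>M M2) Z x
      = (\<integral>\<omega>. generated_norm M2 Z2 (\<chi> i. x $ i * Z1 \<omega> $ i) \<partial>M1)"
    using eq integral_fst'[OF intf] by simp
  have "(\<integral>b. (\<integral>a. ?f a b \<partial>M1) \<partial>M2)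
      = (\<integral>\<omega>. generated_norm M1 Z1 (\<chi> i. x $ i * Z2 \<omega> $ i) \<partial>M2)"
    unfolding generated_norm_def
  proof (rule integral_cong_AE)
    show "AE b in M2. (\<integral>a. ?f a b \<partial>M1)
        = (\<integral>a. (MAX i. \<bar>(\<chi> i. x $ i * Z2 b $ i) $ i\<bar> * Z1 a $ i) \<partial>M1)"
      using Z2(3) by eventually_elim (simp add: abs_mult ac_simps)
  qed measurable
  then show "generated_norm (M1 \<Otimes>\<^sub>M M2) Z x
      = (\<integral>\<omega>. generated_norm M1 Z1 (\<chi> i. x $ i * Z2 \<omega> $ i) \<partial>M2)"
    using eq integral_snd[OF intf] by simp
qed

lemma generated_norm_indep:
  assumes "generator M Z1" "generator M Z2" "prob_space.indep_var M borel Z1 borel Z2"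
  shows "generated_norm M (\<lambda>\<omega>. \<chi> i. Z1 \<omega> $ i * Z2 \<omega> $ i) =
    generated_norm (distr M borel Z1 \<Otimes>\<^sub>M distr M borel Z2) (\<lambda>\<omega>. \<chi> i. fst \<omega> $ i * snd \<omega> $ i)"
proof -
  interpret prob_space M using assms generatorD by blast
  note [measurable] = generatorD(2)[OF assms(1)] generatorD(2)[OF assms(2)]
  have eq: "distr M borel Z1 \<Otimes>\<^sub>M distr M borel Z2
      = distr M (borel \<Otimes>\<^sub>M borel) (\<lambda>\<omega>. (Z1 \<omega>, Z2 \<omega>))"
    using assms(3) by (simp add: indep_var_distribution_eq)
  show ?thesis
    unfolding generated_norm_def eq by (subst integral_distr) simp_all
qed

lemma generated_norm_prod_unique:
  assumes "generator M Z1" "generator M Z2" "prob_space.indep_var M borel Z1 borel Z2"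
    and "generator M' Z1'" "generator M' Z2'" "prob_space.indep_var M' borel Z1' borel Z2'"
    and "generated_norm M Z1 = generated_norm M' Z1'"
    and "generated_norm M Z2 = generated_norm M' Z2'"
  shows "generated_norm M (\<lambda>\<omega>. \<chi> i. Z1 \<omega> $ i * Z2 \<omega> $ i)
       = generated_norm M' (\<lambda>\<omega>. \<chi> i. Z1' \<omega> $ i * Z2' \<omega> $ i)"
proof -
  note g = assms(1,2,4,5)[THEN generator_distr(1)]
  note n = assms(1,2,4,5)[THEN generator_distr(2)]
  show ?thesis
    unfolding generated_norm_indep[OF assms(1-3)] generated_norm_indep[OF assms(4-6)]
    using generated_norm_pair(2,3)[OF g(1) g(2)] generated_norm_pair(2,3)[OF g(3) g(2)]
      generated_norm_pair(2,3)[OF g(3) g(4)] n assms(7,8)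
    by (intro ext) metis
qed

lemma independent_generators_exist:
  fixes N1 N2 :: "real ^ 'd \<Rightarrow> real"
  assumes "D_norm N1" "D_norm N2"
  obtains M :: "((real ^ 'd) \<times> (real ^ 'd)) measure" and Z1 Z2 :: "_ \<Rightarrow> real ^ 'd"
  where "generator M Z1" "generator M Z2"
    "N1 = generated_norm M Z1" "N2 = generated_norm M Z2"
    "prob_space.indep_var M borel Z1 borel Z2"
proof -
  obtain M1 :: "(real ^ 'd) measure" and Z1 :: "_ \<Rightarrow> real ^ 'd"
    where 1: "generator M1 Z1" "N1 = generated_norm M1 Z1"
    using assms(1) unfolding D_norm_def by blast
  obtain M2 :: "(real ^ 'd) measure" and Z2 :: "_ \<Rightarrow> real ^ 'd"
    where 2: "generator M2 Z2" "N2 = generated_norm M2 Z2"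
    using assms(2) unfolding D_norm_def by blast
  define L1 where "L1 = distr M1 borel Z1"
  define L2 where "L2 = distr M2 borel Z2"
  have g: "generator L1 (\<lambda>z. z)" "generator L2 (\<lambda>z. z)"
    and n: "N1 = generated_norm L1 (\<lambda>z. z)" "N2 = generated_norm L2 (\<lambda>z. z)"
    unfolding L1_def L2_def 1(2) 2(2)
    using generator_distr[OF 1(1)] generator_distr[OF 2(1)] by simp_all
  have [measurable_cong, simp]: "sets L1 = sets borel" "sets L2 = sets borel"
    by (auto simp: L1_def L2_def)
  interpret L1: prob_space L1 using g generatorD by blast
  interpret L2: prob_space L2 using g generatorD by blast
  interpret pair_prob_space L1 L2 ..
  have d1: "distr (L1 \<Otimes>\<^sub>M L2) borel fst = L1"
    using L2.distr_pair_fst[of L1] by (simp cong: distr_cong)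
  have d2: "distr (L1 \<Otimes>\<^sub>M L2) borel snd = L2"
  proof (rule measure_eqI)
    fix A assume "A \<in> sets (distr (L1 \<Otimes>\<^sub>M L2) borel snd)"
    then have [measurable]: "A \<in> sets L2" by simp
    have "snd -` A \<inter> space (L1 \<Otimes>\<^sub>M L2) = space L1 \<times> A"
      using sets.sets_into_space[OF \<open>A \<in> sets L2\<close>] by (auto simp: space_pair_measure)
    then show "emeasure (distr (L1 \<Otimes>\<^sub>M L2) borel snd) A = emeasure L2 A"
      using L2.emeasure_pair_measure_Times[OF sets.top[of L1] \<open>A \<in> sets L2\<close>]
        \<open>A \<in> sets L2\<close>
      by (simp add: emeasure_distr L1.emeasure_space_1)
  qed simp
  have AE: "AE \<omega> in L1 \<Otimes>\<^sub>M L2. 0 \<le> fst \<omega> $ i \<and> 0 \<le> snd \<omega> $ i" for i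
  proof (rule AE_pair_measure)
    show "AE a in L1. AE b in L2. 0 \<le> fst (a, b) $ i \<and> 0 \<le> snd (a, b) $ i"
      using generatorD(3)[OF g(1)]
    proof eventually_elim
      case (elim a)
      show ?case using generatorD(3)[OF g(2)] by eventually_elim (use elim in auto)
    qed
  qed measurable
  have i1: "(\<integral>\<omega>. f (fst \<omega>) \<partial>(L1 \<Otimes>\<^sub>M L2)) = integral\<^sup>L L1 f"
    if [measurable]: "f \<in> borel_measurable borel" for f :: "real ^ 'd \<Rightarrow> real"
    by (subst (2) d1[symmetric]) (simp add: integral_distr)
  have i2: "(\<integral>\<omega>. f (snd \<omega>) \<partial>(L1 \<Otimes>\<^sub>M L2)) = integral\<^sup>L L2 f"
    if [measurable]: "f \<in> borel_measurable borel" for f :: "real ^ 'd \<Rightarrow> real"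
    by (subst (2) d2[symmetric]) (simp add: integral_distr)
  show thesis
  proof (rule that[of "L1 \<Otimes>\<^sub>M L2" fst snd])
    show "generator (L1 \<Otimes>\<^sub>M L2) fst" "generator (L1 \<Otimes>\<^sub>M L2) snd"
      using AE generatorD(5)[OF g(1)] generatorD(5)[OF g(2)]
      by (auto simp: generator_def i1[of "\<lambda>z. z $ _"] i2[of "\<lambda>z. z $ _"] prob_space_axioms)
    show "N1 = generated_norm (L1 \<Otimes>\<^sub>M L2) fst" "N2 = generated_norm (L1 \<Otimes>\<^sub>M L2) snd"
      unfolding n generated_norm_def
      by (auto intro!: ext i1[of "\<lambda>z. MAX i. \<bar>_ $ i\<bar> * z $ i", symmetric]
          i2[of "\<lambda>z. MAX i. \<bar>_ $ i\<bar> * z $ i", symmetric])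
    show "indep_var borel fst borel snd"
      unfolding indep_var_distribution_eq d1 d2
      by (auto intro!: distr_id2[symmetric] sets_pair_measure_cong)
  qed
qed

lemma D_prod_well_defined:
  fixes N1 N2 :: "real ^ 'd \<Rightarrow> real"
  assumes "D_norm N1" "D_norm N2"
  shows "\<exists>!N. \<exists>(M :: ((real ^ 'd) \<times> (real ^ 'd)) measure) Z1 Z2.
        generator M Z1 \<and> N1 = generated_norm M Z1 \<and>
        generator M Z2 \<and> N2 = generated_norm M Z2 \<and>
        prob_space.indep_var M borel Z1 borel Z2 \<and>
        N = generated_norm M (\<lambda>\<omega>. \<chi> i. Z1 \<omega> $ i * Z2 \<omega> $ i)"
proof (rule ex_ex1I)
  show "\<exists>N (M :: ((real ^ 'd) \<times> (real ^ 'd)) measure) Z1 Z2.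
        generator M Z1 \<and> N1 = generated_norm M Z1 \<and>
        generator M Z2 \<and> N2 = generated_norm M Z2 \<and>
        prob_space.indep_var M borel Z1 borel Z2 \<and>
        N = generated_norm M (\<lambda>\<omega>. \<chi> i. Z1 \<omega> $ i * Z2 \<omega> $ i)"
    by (rule independent_generators_exist[OF assms]) blast
qed (elim exE conjE, hypsubst, rule generated_norm_prod_unique, assumption+)

lemma D_prod_generated_norm:
  fixes Z1 Z2 :: "'a \<Rightarrow> real ^ 'd"
  assumes "generator M Z1" "generator M Z2" "prob_space.indep_var M borel Z1 borel Z2"
  shows "D_prod (generated_norm M Z1) (generated_norm M Z2)
       = generated_norm M (\<lambda>\<omega>. \<chi> i. Z1 \<omega> $ i * Z2 \<omega> $ i)"
proof -
  have D: "D_norm (generated_norm M Z1)" "D_norm (generated_norm M Z2)"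
    using assms D_norm_generated_norm by blast+
  obtain M' :: "((real ^ 'd) \<times> (real ^ 'd)) measure" and Z1' Z2' :: "_ \<Rightarrow> real ^ 'd"
    where *: "generator M' Z1'" "generated_norm M Z1 = generated_norm M' Z1'"
      "generator M' Z2'" "generated_norm M Z2 = generated_norm M' Z2'"
      "prob_space.indep_var M' borel Z1' borel Z2'"
      "D_prod (generated_norm M Z1) (generated_norm M Z2)
         = generated_norm M' (\<lambda>\<omega>. \<chi> i. Z1' \<omega> $ i * Z2' \<omega> $ i)"
    using theI'[OF D_prod_well_defined[OF D]] unfolding D_prod_def[symmetric] by blast
  show ?thesis
    unfolding *(6)
    by (rule generated_norm_prod_unique[symmetric]) (fact assms *)+
qed

lemma D_norm_D_prod:
  fixes N1 N2 :: "real ^ 'd \<Rightarrow> real"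
  assumes "D_norm N1" "D_norm N2"
  shows "D_norm (D_prod N1 N2)"
proof (rule independent_generators_exist[OF assms])
  fix M :: "((real ^ 'd) \<times> (real ^ 'd)) measure" and Z1 Z2 :: "_ \<Rightarrow> real ^ 'd"
  assume *: "generator M Z1" "generator M Z2" "N1 = generated_norm M Z1"
    "N2 = generated_norm M Z2" "prob_space.indep_var M borel Z1 borel Z2"
  show ?thesis
    unfolding *(3,4) D_prod_generated_norm[OF *(1,2,5)] generated_norm_indep[OF *(1,2,5)]
    by (rule D_norm_generated_norm,
        rule generated_norm_pair(1)[OF generator_distr(1)[OF *(1)] generator_distr(1)[OF *(2)]])
qed

end

theory Submission
  imports Defs
begin

text \<open>The limit can be computed. The affinity E(sqrt(Z_i Z_j)) of two components of a generator lies
  in [0,1], equals 1 iff Z_i = Z_j almost surely, and is multiplicative under products of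
  independent generators. In the n-fold power of a D-norm each affinity is therefore either 1, for all
  pairs in an equivalence relation R, or tends to 0. As affinity 0 means disjoint supports, the
  maximum of the |x_i| Z_i turns in the limit into the sum over the blocks B of R of
  max_{i in B} |x_i|. This is again a D-norm: choose k uniformly from the index set and let Z be a
  multiple of the indicator of the block of k. Its affinities are 0 or 1, hence unchanged by
  squaring, which gives idempotence.\<close>

section \<open>Hellinger affinities of the components of a generator\<close>

text \<open>For a generator this is the Bhattacharyya coefficient of the probability measures with
  densities Z_i and Z_j relative to \<open>M\<close>.\<close>

definition affinity :: "'a measure \<Rightarrow> ('a \<Rightarrow> real ^ 'd) \<Rightarrow> 'd \<Rightarrow> 'd \<Rightarrow> real" where
  "affinity M Z i j = (\<integral>\<omega>. sqrt (Z \<omega> $ i * Z \<omega> $ j) \<partial>M)"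

lemma integrable_sqrt_mult:
  fixes f g :: "'a \<Rightarrow> real"
  assumes "integrable M f" "integrable M g"
  shows "integrable M (\<lambda>\<omega>. sqrt (f \<omega> * g \<omega>))"
proof (rule Bochner_Integration.integrable_bound)
  show "integrable M (\<lambda>\<omega>. (\<bar>f \<omega>\<bar> + \<bar>g \<omega>\<bar>) / 2)" using assms by auto
  \<comment> \<open>No signs are assumed for \<open>f\<close> and \<open>g\<close>. Since
    \<open>sqrt\<close> is extended to an odd function, |sqrt(f g)| = sqrt(|f| |g|), to which the
    arithmetic-geometric mean inequality applies.\<close>
  have "\<bar>sqrt (f \<omega> * g \<omega>)\<bar> \<le> (\<bar>f \<omega>\<bar> + \<bar>g \<omega>\<bar>) / 2" for \<omega>
    using arith_geo_mean_sqrt[of "\<bar>f \<omega>\<bar>" "\<bar>g \<omega>\<bar>"]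
    by (metis abs_ge_zero abs_mult real_sqrt_abs')
  then show "AE \<omega> in M. norm (sqrt (f \<omega> * g \<omega>)) \<le> norm ((\<bar>f \<omega>\<bar> + \<bar>g \<omega>\<bar>) / 2)"
    by (intro AE_I2) auto
qed (use assms in measurable)

text \<open>The expectation of (sqrt Z_i - sqrt Z_j)^2, a squared Hellinger distance, equals 2 - 2
  E(sqrt(Z_i Z_j)). It is nonnegative, and it vanishes exactly when the two components agree almost
  surely.\<close>

lemma
  assumes "generator M Z"
  shows affinity_nonneg: "0 \<le> affinity M Z i j"
    and affinity_le_1: "affinity M Z i j \<le> 1"
    and affinity_eq_1_iff: "affinity M Z i j = 1 \<longleftrightarrow> (AE \<omega> in M. Z \<omega> $ i = Z \<omega> $ j)"
proof -
  note Z = generatorD[OF assms]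
  note [measurable] = Z(2)
  let ?q = "\<lambda>\<omega>. (sqrt (Z \<omega> $ i) - sqrt (Z \<omega> $ j))\<^sup>2"
  let ?p = "\<lambda>\<omega>. Z \<omega> $ i + Z \<omega> $ j - 2 * sqrt (Z \<omega> $ i * Z \<omega> $ j)"
  have AE: "AE \<omega> in M. ?q \<omega> = ?p \<omega>"
    using Z(3) by eventually_elim (simp add: power2_diff real_sqrt_mult)
  have ip: "integrable M ?p"
    by (intro Bochner_Integration.integrable_add Bochner_Integration.integrable_diff
        integrable_mult_right integrable_sqrt_mult Z)
  have iq: "integrable M ?q"
    by (rule integrable_cong_AE_imp[OF ip]) (use AE in \<open>auto elim: eventually_mono\<close>)
  have "integral\<^sup>L M ?q = integral\<^sup>L M ?p"
    by (rule integral_cong_AE) (use AE in auto)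
  also have "\<dots> = 2 - 2 * affinity M Z i j"
    using integrable_sqrt_mult[OF Z(4)[of i] Z(4)[of j]] by (simp add: Z(4,5) affinity_def)
  finally have eq: "integral\<^sup>L M ?q = 2 - 2 * affinity M Z i j" .
  show "0 \<le> affinity M Z i j" unfolding affinity_def
    by (rule integral_nonneg_AE) (use Z(3) in \<open>auto elim: eventually_mono\<close>)
  have "0 \<le> integral\<^sup>L M ?q" by simp
  then show "affinity M Z i j \<le> 1" using eq by linarith
  have "affinity M Z i j = 1 \<longleftrightarrow> integral\<^sup>L M ?q = 0" using eq by auto
  also have "\<dots> \<longleftrightarrow> (AE \<omega> in M. ?q \<omega> = 0)"
    by (rule integral_nonneg_eq_0_iff_AE[OF iq]) simp
  also have "\<dots> \<longleftrightarrow> (AE \<omega> in M. Z \<omega> $ i = Z \<omega> $ j)" by simp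
  finally show "affinity M Z i j = 1 \<longleftrightarrow> (AE \<omega> in M. Z \<omega> $ i = Z \<omega> $ j)" .
qed

text \<open>The square root factors into a function of each coordinate, so Fubini splits the
  integral.\<close>

lemma affinity_pair:
  assumes "generator M1 Z1" "generator M2 Z2"
  shows "affinity (M1 \<Otimes>\<^sub>M M2) (\<lambda>\<omega>. \<chi> i. Z1 (fst \<omega>) $ i * Z2 (snd \<omega>) $ i) i j
       = affinity M1 Z1 i j * affinity M2 Z2 i j"
proof -
  note Z1 = generatorD[OF assms(1)] and Z2 = generatorD[OF assms(2)]
  interpret M1: prob_space M1 by fact
  interpret M2: prob_space M2 by fact
  interpret pair_prob_space M1 M2 ..
  note [measurable] = Z1(2) Z2(2)
  let ?f = "\<lambda>a. sqrt (Z1 a $ i * Z1 a $ j)" and ?g = "\<lambda>b. sqrt (Z2 b $ i * Z2 b $ j)"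
  have "integrable M1 ?f" "integrable M2 ?g" by (intro integrable_sqrt_mult Z1 Z2)+
  then have "integrable (M1 \<Otimes>\<^sub>M M2) (\<lambda>(a, b). ?f a * ?g b)"
    by (intro Fubini_integrable) (auto simp: abs_mult)
  from integral_fst'[OF this]
  have "(\<integral>\<omega>. ?f (fst \<omega>) * ?g (snd \<omega>) \<partial>(M1 \<Otimes>\<^sub>M M2)) = affinity M1 Z1 i j * affinity M2 Z2 i j"
    by (simp add: affinity_def split_beta')
  then show ?thesis by (simp add: affinity_def real_sqrt_mult ac_simps)
qed

lemma affinity_distr:
  assumes "generator M Z"
  shows "affinity (distr M borel Z) (\<lambda>z. z) i j = affinity M Z i j"
  using generatorD(2)[OF assms] by (simp add: affinity_def integral_distr)

section \<open>Products and powers through product measures\<close>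

text \<open>Allows the two generators to live on different sample spaces, of different types;
  independence is built into the product measure.\<close>

lemma D_prod_eq_generated_norm_pair:
  fixes Z1 :: "'a \<Rightarrow> real ^ 'd" and Z2 :: "'b \<Rightarrow> real ^ 'd"
  assumes "generator M1 Z1" "generator M2 Z2"
  shows "D_prod (generated_norm M1 Z1) (generated_norm M2 Z2)
    = generated_norm (M1 \<Otimes>\<^sub>M M2) (\<lambda>\<omega>. \<chi> i. Z1 (fst \<omega>) $ i * Z2 (snd \<omega>) $ i)"
proof (rule independent_generators_exist[OF assms[THEN D_norm_generated_norm]])
  fix M :: "((real ^ 'd) \<times> (real ^ 'd)) measure" and Y1 Y2 :: "_ \<Rightarrow> real ^ 'd"
  assume *: "generator M Y1" "generator M Y2" "generated_norm M1 Z1 = generated_norm M Y1"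
    "generated_norm M2 Z2 = generated_norm M Y2" "prob_space.indep_var M borel Y1 borel Y2"
  note g = *(1,2)[THEN generator_distr(1)] and n = *(1,2)[THEN generator_distr(2)]
  have "generated_norm (distr M borel Y1 \<Otimes>\<^sub>M distr M borel Y2) (\<lambda>\<omega>. \<chi> i. fst \<omega> $ i * snd \<omega> $ i) x
    = generated_norm (M1 \<Otimes>\<^sub>M M2) (\<lambda>\<omega>. \<chi> i. Z1 (fst \<omega>) $ i * Z2 (snd \<omega>) $ i) x" for x
    \<comment> \<open>The generators are exchanged one at a time. Integrating out the second factor
      first shows that it enters only through its norm, so \<open>Y2\<close> may become
      \<open>Z2\<close>; the other order of integration then turns \<open>Y1\<close> into
      \<open>Z1\<close>.\<close>
    by (simp only: generated_norm_pair(2)[OF g] n(2) *(4)[symmetric]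
        generated_norm_pair(2)[OF g(1) assms(2), symmetric])
      (simp only: generated_norm_pair(3)[OF g(1) assms(2)] generated_norm_pair(3)[OF assms]
        n(1) *(3))
  moreover have "D_prod (generated_norm M1 Z1) (generated_norm M2 Z2)
    = generated_norm (distr M borel Y1 \<Otimes>\<^sub>M distr M borel Y2) (\<lambda>\<omega>. \<chi> i. fst \<omega> $ i * snd \<omega> $ i)"
    using D_prod_generated_norm[OF *(1,2,5)] generated_norm_indep[OF *(1,2,5)]
    by (simp only: *(3,4))
  ultimately show ?thesis by (simp only: fun_eq_iff) simp
qed

text \<open>One generator has to carry both the norm of the power and its affinities, so the
  induction builds it explicitly, one independent factor at a time.\<close>

lemma D_iprod_generator:
  fixes M :: "'a measure" and Z :: "'a \<Rightarrow> real ^ 'd"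
  assumes gen: "generator M Z" and D: "\<And>i. 1 \<le> i \<Longrightarrow> D i = generated_norm M Z"
  shows "\<exists>(M' :: (real ^ 'd) measure) Z'. generator M' Z' \<and>
    D_iprod D (Suc n) = generated_norm M' Z' \<and>
    (\<forall>i j. affinity M' Z' i j = affinity M Z i j ^ Suc n)"
proof (induction n)
  case 0
  show ?case
    by (intro exI[of _ "distr M borel Z"] exI[of _ "\<lambda>z. z"])
      (simp add: generator_distr[OF gen] affinity_distr[OF gen] D)
next
  case (Suc n)
  then obtain M' :: "(real ^ 'd) measure" and Z' where *: "generator M' Z'"
    "D_iprod D (Suc n) = generated_norm M' Z'"
    "\<And>i j. affinity M' Z' i j = affinity M Z i j ^ Suc n" by blast
  let ?M = "M \<Otimes>\<^sub>M M'" and ?Z = "\<lambda>\<omega>. \<chi> i. Z (fst \<omega>) $ i * Z' (snd \<omega>) $ i"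
  have g: "generator ?M ?Z" by (rule generated_norm_pair(1)[OF gen *(1)])
  have "D_iprod D (Suc (Suc n)) = generated_norm ?M ?Z"
    using D_prod_eq_generated_norm_pair[OF gen *(1)] by (simp add: D *(2))
  moreover have "affinity ?M ?Z i j = affinity M Z i j ^ Suc (Suc n)" for i j
    using affinity_pair[OF gen *(1)] by (simp add: *(3))
  ultimately show ?case
    \<comment> \<open>The product space has a new type; passing to the law of \<open>?Z\<close>
      returns to a measure on R^d and preserves norm and affinities.\<close>
    by (intro exI[of _ "distr ?M borel ?Z"] exI[of _ "\<lambda>z. z"])
      (simp only: generator_distr[OF g] affinity_distr[OF g], simp)
qed

section \<open>Comparison with sums of sup-norms over blocks\<close>

text \<open>A single block gives the sup-norm, singleton blocks give the l1-norm.\<close>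

definition block_norm :: "('d \<times> 'd) set \<Rightarrow> real ^ 'd \<Rightarrow> real" where
  "block_norm R x = (\<Sum>B\<in>UNIV // R. MAX i\<in>B. \<bar>x $ i\<bar>)"

text \<open>With \<open>t\<close> a maximiser, u_s <= u_t gives u_s <= sqrt(u_s u_t). The excess of
  a sum over its maximum is thus bounded by geometric means, whose expectations are affinities up to
  constants.\<close>

lemma sum_le_Max_plus_sqrt:
  fixes u :: "'b \<Rightarrow> real"
  assumes "finite S" "S \<noteq> {}" "\<And>s. s \<in> S \<Longrightarrow> 0 \<le> u s"
  obtains t where "t \<in> S" "(\<Sum>s\<in>S. u s) \<le> u t + (\<Sum>s\<in>S - {t}. sqrt (u s * u t))"
proof -
  have "Max (u ` S) \<in> u ` S" using assms by (intro Max_in) auto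
  then obtain t where t: "t \<in> S" "Max (u ` S) = u t" by auto
  have "u s \<le> sqrt (u s * u t)" if "s \<in> S - {t}" for s
  proof (rule real_le_rsqrt)
    have "u s \<le> u t" using t(2) Max_ge[of "u ` S" "u s"] that assms(1) by auto
    then show "(u s)\<^sup>2 \<le> u s * u t"
      using assms(3) that by (auto simp: power2_eq_square intro: mult_left_mono)
  qed
  then have "(\<Sum>s\<in>S - {t}. u s) \<le> (\<Sum>s\<in>S - {t}. sqrt (u s * u t))" by (rule sum_mono)
  then show thesis
    using that[OF t(1)] sum.remove[OF assms(1) t(1), of u] by auto
qed

text \<open>Components within a block coincide almost surely, so each block contributes its largest
  |x_i| times a common factor. The upper bound replaces the maximum over blocks by their sum; the
  lower bound controls the loss by the preceding lemma, with cross terms only between different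
  blocks.\<close>

lemma generated_norm_block_norm_bounds:
  fixes Z :: "'a \<Rightarrow> real ^ 'd"
  assumes gen: "generator M Z" and R: "equiv UNIV R"
    and aff: "\<And>i j. (i, j) \<in> R \<Longrightarrow> affinity M Z i j = 1"
  shows "generated_norm M Z x \<le> block_norm R x" (is ?upper)
    and "block_norm R x \<le> generated_norm M Z x +
      (\<Sum>(i, j)\<in>- R. sqrt (\<bar>x $ i\<bar> * \<bar>x $ j\<bar>) * affinity M Z i j)" (is ?lower)
proof -
  note Z = generatorD[OF gen]
  have "\<exists>b\<in>B. (MAX i\<in>B. \<bar>x $ i\<bar>) = \<bar>x $ b\<bar>" if "B \<in> UNIV // R" for B
  proof -
    have "(MAX i\<in>B. \<bar>x $ i\<bar>) \<in> (\<lambda>i. \<bar>x $ i\<bar>) ` B"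
      using in_quotient_imp_non_empty[OF R that] by (intro Max_in) auto
    then show ?thesis by blast
  qed
  \<comment> \<open>\<open>b B\<close> is an index at which |x_i| is largest in the block
    \<open>B\<close>.\<close>
  then obtain b where b: "\<And>B. B \<in> UNIV // R \<Longrightarrow> b B \<in> B"
    "\<And>B. B \<in> UNIV // R \<Longrightarrow> (MAX i\<in>B. \<bar>x $ i\<bar>) = \<bar>x $ b B\<bar>" by metis
  let ?S = "UNIV // R" and ?m = "\<lambda>\<omega>. MAX i. \<bar>x $ i\<bar> * Z \<omega> $ i"
  let ?s = "\<lambda>\<omega>. \<Sum>B\<in>?S. \<bar>x $ b B\<bar> * Z \<omega> $ b B"
  let ?e = "\<lambda>\<omega>. \<Sum>(i, j)\<in>- R. sqrt (\<bar>x $ i\<bar> * \<bar>x $ j\<bar>) * sqrt (Z \<omega> $ i * Z \<omega> $ j)"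
  have im: "integrable M ?m" by (intro integrable_MAX integrable_mult_right Z)
  have isum: "integrable M ?s"
    by (intro Bochner_Integration.integrable_sum integrable_mult_right Z)
  have ie: "integrable M ?e"
    by (auto intro!: Bochner_Integration.integrable_sum integrable_mult_right integrable_sqrt_mult Z)
  have s: "integral\<^sup>L M ?s = block_norm R x"
    by (simp add: block_norm_def b(2) Z(4,5))
  have e: "integral\<^sup>L M ?e = (\<Sum>(i, j)\<in>- R. sqrt (\<bar>x $ i\<bar> * \<bar>x $ j\<bar>) * affinity M Z i j)"
    by (subst Bochner_Integration.integral_sum)
       (auto intro!: integrable_mult_right integrable_sqrt_mult Z simp: affinity_def split_beta')
  have eq: "AE \<omega> in M. \<forall>p\<in>R. Z \<omega> $ fst p = Z \<omega> $ snd p"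
    by (intro AE_finite_allI) (use affinity_eq_1_iff[OF gen] aff in auto)
  have "integral\<^sup>L M ?m \<le> integral\<^sup>L M ?s"
  proof (rule integral_mono_AE[OF im isum])
    show "AE \<omega> in M. ?m \<omega> \<le> ?s \<omega>"
      using eq Z(3)
    proof eventually_elim
      case (elim \<omega>)
      have "\<bar>x $ i\<bar> * Z \<omega> $ i \<le> ?s \<omega>" for i
      proof -
        let ?B = "R `` {i}"
        have B: "?B \<in> ?S" by (auto intro: quotientI)
        then have "(i, b ?B) \<in> R" using b(1) by auto
        then have "Z \<omega> $ i = Z \<omega> $ b ?B" using elim(1) by force
        moreover have "\<bar>x $ i\<bar> \<le> \<bar>x $ b ?B\<bar>"
          unfolding b(2)[OF B, symmetric]
          using equiv_class_self[OF R, of i] by (intro Max_ge) auto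
        ultimately have "\<bar>x $ i\<bar> * Z \<omega> $ i \<le> \<bar>x $ b ?B\<bar> * Z \<omega> $ b ?B"
          using elim(2) by (auto intro: mult_right_mono)
        also have "\<dots> \<le> ?s \<omega>"
          using B elim(2) by (intro member_le_sum) auto
        finally show ?thesis .
      qed
      then show ?case by (intro Max.boundedI) auto
    qed
  qed
  then show ?upper by (simp add: s generated_norm_def)
  have "integral\<^sup>L M ?s \<le> (\<integral>\<omega>. ?m \<omega> + ?e \<omega> \<partial>M)"
  proof (rule integral_mono_AE[OF isum])
    show "integrable M (\<lambda>\<omega>. ?m \<omega> + ?e \<omega>)" using im ie by (rule Bochner_Integration.integrable_add)
    show "AE \<omega> in M. ?s \<omega> \<le> ?m \<omega> + ?e \<omega>"
      using Z(3)
    proof eventually_elim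
      case (elim \<omega>)
      define u where "u B = \<bar>x $ b B\<bar> * Z \<omega> $ b B" for B
      have "finite ?S" "?S \<noteq> {}" by (auto simp: quotient_def)
      then obtain C where C: "C \<in> ?S" "(\<Sum>B\<in>?S. u B) \<le> u C + (\<Sum>B\<in>?S - {C}. sqrt (u B * u C))"
        using sum_le_Max_plus_sqrt[of ?S u] elim by (auto simp: u_def)
      have "(\<Sum>B\<in>?S - {C}. sqrt (u B * u C)) \<le> ?e \<omega>"
      \<comment> \<open>The term of \<open>B\<close> is charged to the pair (\<open>b B\<close>,
        \<open>b C\<close>), which lies outside \<open>R\<close> because \<open>B\<close> and
        \<open>C\<close> differ. The class of the first entry recovers \<open>B\<close>, so no pair
        is charged twice.\<close>
      proof (rule sum_le_included[where i = "\<lambda>(i, j). R `` {i}"])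
        show "\<forall>p\<in>- R. 0 \<le> (case p of (i, j) \<Rightarrow> sqrt (\<bar>x $ i\<bar> * \<bar>x $ j\<bar>) * sqrt (Z \<omega> $ i * Z \<omega> $ j))"
          using elim by auto
        show "\<forall>B\<in>?S - {C}. \<exists>p\<in>- R. (case p of (i, j) \<Rightarrow> R `` {i}) = B \<and>
          sqrt (u B * u C) \<le> (case p of (i, j) \<Rightarrow> sqrt (\<bar>x $ i\<bar> * \<bar>x $ j\<bar>) * sqrt (Z \<omega> $ i * Z \<omega> $ j))"
        proof
          fix B assume B: "B \<in> ?S - {C}"
          have "(b B, b C) \<notin> R"
            using quotient_eqI[OF R _ C(1) b(1) b(1)[OF C(1)], of B] B by auto
          moreover have "R `` {b B} = B"
            using B b(1) R by (metis DiffD1 Image_singleton_iff equiv_class_eq_iff quotientE)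
          moreover have "sqrt (u B * u C) = sqrt (\<bar>x $ b B\<bar> * \<bar>x $ b C\<bar>) * sqrt (Z \<omega> $ b B * Z \<omega> $ b C)"
            by (simp add: u_def real_sqrt_mult)
          ultimately show "\<exists>p\<in>- R. (case p of (i, j) \<Rightarrow> R `` {i}) = B \<and>
            sqrt (u B * u C) \<le> (case p of (i, j) \<Rightarrow> sqrt (\<bar>x $ i\<bar> * \<bar>x $ j\<bar>) * sqrt (Z \<omega> $ i * Z \<omega> $ j))"
            by (intro bexI[of _ "(b B, b C)"]) auto
        qed
      qed auto
      moreover have "u C \<le> ?m \<omega>" unfolding u_def by (intro Max_ge) auto
      ultimately show ?case using C(2) unfolding u_def by linarith
    qed
  qed
  then show ?lower using im ie by (simp add: s e[symmetric] generated_norm_def)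
qed

text \<open>The error term only involves affinities of pairs outside \<open>R\<close>, which are 0
  here, so the two bounds meet.\<close>

lemma generated_norm_eq_block_norm:
  fixes Z :: "'a \<Rightarrow> real ^ 'd"
  assumes "generator M Z" "equiv UNIV R"
    and aff: "\<And>i j. affinity M Z i j = of_bool ((i, j) \<in> R)"
  shows "generated_norm M Z = block_norm R"
proof
  fix x
  have "(\<Sum>(i, j)\<in>- R. sqrt (\<bar>x $ i\<bar> * \<bar>x $ j\<bar>) * affinity M Z i j) = 0"
    by (intro sum.neutral) (auto simp: aff)
  then show "generated_norm M Z x = block_norm R x"
    using generated_norm_block_norm_bounds[OF assms(1,2), of x] aff by (simp add: antisym)
qed

section \<open>Block norms are idempotent D-norms\<close>

lemma block_generator_exists:
  fixes R :: "('d :: finite \<times> 'd) set"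
  assumes R: "equiv UNIV R"
  obtains Z :: "'d \<Rightarrow> real ^ 'd" where "generator (measure_pmf (pmf_of_set UNIV)) Z"
    "\<And>i j. affinity (measure_pmf (pmf_of_set UNIV)) Z i j = of_bool ((i, j) \<in> R)"
proof -
  define M where "M = measure_pmf (pmf_of_set (UNIV :: 'd set))"
  \<comment> \<open>The random index \<open>k\<close> hits the class of i with probability (class
    size) / \<open>CARD('d)\<close>; the factor is the reciprocal, which makes the expectation
    1.\<close>
  define Z :: "'d \<Rightarrow> real ^ 'd" where
    "Z k = (\<chi> i. of_bool (k \<in> R `` {i}) * (CARD('d) / card (R `` {i})))" for k
  have pos: "card (R `` {i}) \<noteq> 0" for i
    using equiv_class_self[OF R, of i] by auto
  have int: "(\<integral>k. f k \<partial>M) = (\<Sum>k\<in>UNIV. f k) / CARD('d)" for f :: "'d \<Rightarrow> real"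
    by (simp add: M_def integral_pmf_of_set)
  have one: "(\<integral>k. Z k $ i \<partial>M) = 1" for i
  proof -
    have "(\<Sum>k\<in>UNIV. of_bool (k \<in> R `` {i})) = real (card (R `` {i}))"
      by (simp del: Image_singleton_iff)
    then show ?thesis
      using pos[of i]
      by (simp add: int Z_def sum_distrib_right[symmetric] del: Image_singleton_iff sum_of_bool_eq)
  qed
  have gen: "generator M Z"
    unfolding generator_def using one
    by (simp add: M_def measure_pmf.prob_space_axioms) (simp add: Z_def)
  moreover have "affinity M Z i j = of_bool ((i, j) \<in> R)" for i j
  proof (cases "(i, j) \<in> R")
    case True
    then have "R `` {i} = R `` {j}" by (rule equiv_class_eq[OF R])
    then have "Z k $ i = Z k $ j" for k by (simp add: Z_def del: Image_singleton_iff)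
    then show ?thesis using True affinity_eq_1_iff[OF gen, of i j] by simp
  next
    case False
    then have "R `` {i} \<inter> R `` {j} = {}" using equiv_class_nondisjoint[OF R] by blast
    then have "Z k $ i * Z k $ j = 0" for k by (auto simp: Z_def)
    then have "affinity M Z i j = 0"
      by (simp only: affinity_def real_sqrt_zero Bochner_Integration.integral_zero)
    then show ?thesis using False by simp
  qed
  ultimately show thesis using that unfolding M_def by blast
qed

text \<open>Squaring leaves affinities in {0, 1} unchanged, so the generator and its independent
  product both generate the block norm of the same \<open>R\<close>.\<close>

lemma idempotent_block_norm:
  fixes R :: "('d :: finite \<times> 'd) set"
  assumes R: "equiv UNIV R"
  shows "idempotent_D_norm (block_norm R)"
proof -
  let ?M = "measure_pmf (pmf_of_set (UNIV :: 'd set))"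
  obtain Z :: "'d \<Rightarrow> real ^ 'd" where Z: "generator ?M Z"
    "\<And>i j. affinity ?M Z i j = of_bool ((i, j) \<in> R)"
    using block_generator_exists[OF R] by blast
  note N = generated_norm_eq_block_norm[OF Z(1) R Z(2)]
  have "D_prod (block_norm R) (block_norm R) = block_norm R"
    using D_prod_eq_generated_norm_pair[OF Z(1) Z(1)] unfolding N
    by (simp add: generated_norm_eq_block_norm[OF generated_norm_pair(1)[OF Z(1) Z(1)] R]
        affinity_pair[OF Z(1) Z(1)] Z(2))
  then show ?thesis
    using D_norm_generated_norm[OF Z(1)] by (simp add: idempotent_D_norm_def N)
qed

section \<open>Convergence of the powers\<close>

text \<open>Affinity 1 means almost sure equality, from which transitivity is immediate.\<close>

lemma equiv_affinity:
  assumes "generator M Z"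
  shows "equiv UNIV {(i, j). affinity M Z i j = 1}"
proof (rule equivI)
  show "trans {(i, j). affinity M Z i j = 1}"
    unfolding trans_def affinity_eq_1_iff[OF assms] by auto
qed (auto simp: refl_on_def sym_def affinity_eq_1_iff[OF assms] elim: eventually_mono)

theorem theorem4p3:
  fixes N :: "real ^ 'd \<Rightarrow> real"
    and D :: "nat \<Rightarrow> real ^ 'd \<Rightarrow> real"
  assumes "D_norm N"
    and "\<And>i. 1 \<le> i \<Longrightarrow> D i = N"
  shows "\<exists>Nstar. (\<forall>x. (\<lambda>n. D_iprod D n x) \<longlonglongrightarrow> Nstar x) \<and> idempotent_D_norm Nstar"
proof -
  obtain M :: "(real ^ 'd) measure" and Z where gen: "generator M Z" and N: "N = generated_norm M Z"
    using assms(1) unfolding D_norm_def by blast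
  define R where "R = {(i, j). affinity M Z i j = 1}"
  have R: "equiv UNIV R" unfolding R_def by (rule equiv_affinity[OF gen])
  have "(\<lambda>n. D_iprod D n x) \<longlonglongrightarrow> block_norm R x" for x
  \<comment> \<open>The shift skips index 0, where \<open>D_iprod\<close> has a merely conventional
    value, and matches \<open>Suc n\<close> factors with the exponent \<open>Suc n\<close> in
    \<open>?e\<close>.\<close>
  proof (rule LIMSEQ_imp_Suc, rule tendsto_sandwich)
    let ?e = "\<lambda>n. \<Sum>(i, j)\<in>- R. sqrt (\<bar>x $ i\<bar> * \<bar>x $ j\<bar>) * affinity M Z i j ^ Suc n"
    have *: "D_iprod D (Suc n) x \<le> block_norm R x \<and> block_norm R x \<le> D_iprod D (Suc n) x + ?e n" for n
    proof -
      obtain M' :: "(real ^ 'd) measure" and Z' where Z': "generator M' Z'"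
        "D_iprod D (Suc n) = generated_norm M' Z'"
        "\<And>i j. affinity M' Z' i j = affinity M Z i j ^ Suc n"
        using D_iprod_generator[OF gen, of D n] assms(2) N by blast
      have "affinity M' Z' i j = 1" if "(i, j) \<in> R" for i j
        using that by (simp add: Z'(3) R_def)
      from generated_norm_block_norm_bounds[OF Z'(1) R this, of x]
      show ?thesis by (simp add: Z'(2,3))
    qed
    show "\<forall>\<^sub>F n in sequentially. block_norm R x - ?e n \<le> D_iprod D (Suc n) x"
      using * by (intro always_eventually) (auto simp: algebra_simps)
    show "\<forall>\<^sub>F n in sequentially. D_iprod D (Suc n) x \<le> block_norm R x"
      using * by auto
    have "(\<lambda>n. affinity M Z i j ^ Suc n) \<longlonglongrightarrow> 0" if "(i, j) \<in> - R" for i j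
    proof (rule LIMSEQ_Suc, rule LIMSEQ_realpow_zero)
      show "0 \<le> affinity M Z i j" by (rule affinity_nonneg[OF gen])
      show "affinity M Z i j < 1"
        using affinity_le_1[OF gen, of i j] that by (simp add: R_def)
    qed
    \<comment> \<open>The sum is finite, so termwise convergence of the powers to 0
      suffices.\<close>
    then have "?e \<longlonglongrightarrow> (\<Sum>(i, j)\<in>- R. 0)"
      by (intro tendsto_sum) (auto simp del: power_Suc intro!: tendsto_mult_right_zero)
    then show "(\<lambda>n. block_norm R x - ?e n) \<longlonglongrightarrow> block_norm R x"
      using tendsto_diff[OF tendsto_const, of ?e 0 sequentially "block_norm R x"] by simp
  qed simp
  then show ?thesis using idempotent_block_norm[OF R] by blast
qed

end
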